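(* Let $m,N,k\ge 1$ be integers and let $t$ be a real number. Assume that $A\in\mathbb{R}^{m\times N}$ satisfies the S-RIP of order $tk$ with bounds $\theta_-,\theta_+\in(0,2)$ such that $$t\ge\max\left\{\frac{1}{2\theta_--\theta_-^2},\ \frac{1}{2\theta_+-\theta_+^2}\right\}.$$ Let $x_0\in\mathbb{R}^N$ and $\epsilon\ge 0$. Then any solution $\hat x$ of $$\min_{x\in\mathbb{R}^N}\|x\|_1\quad\text{subject to}\quad \bigl\||Ax|-|Ax_0|\bigr\|_2^2\le\epsilon^2$$ satisfies $$\min\{\|\hat x-x_0\|_2,\ \|\hat x+x_0\|_2\}\le c_1\epsilon+c_2\frac{2\sigma_k(x_0)_1}{\sqrt{k}},$$ where, with $\delta:=\max\{1-\theta_-,\theta_+-1\}$, $$c_1=\frac{\sqrt{2(1+\delta)}}{1-\sqrt{t/(t-1)}\,\delta},\qquad c_2=\frac{\sqrt{2}\,\delta+\sqrt{(\sqrt{t(t-1)}-\delta t)\delta}}{\sqrt{t(t-1)}-\delta t}+1.$$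
   Context: For $y\in\mathbb{R}^m$, $|y|$ denotes the vector of entrywise absolute values. A vector is $r$-sparse if it has at most $r$ nonzero entries. $\sigma_k(x)_1:=\min\{\|x-z\|_1: z\in\mathbb{R}^N \text{ is } k\text{-sparse}\}$. For $A=[a_1,\dots,a_m]^\top\in\mathbb{R}^{m\times N}$ and $I\subseteq[m]:=\{1,\dots,m\}$, $A_I$ is the submatrix of $A$ keeping only the rows with indices in $I$. $A$ has the Strong Restricted Isometry Property (S-RIP) of order $r$ with bounds $\theta_-,\theta_+\in(0,2)$ if $$\theta_-\|x\|_2^2\le\min_{I\subseteq[m],\,|I|\ge m/2}\|A_Ix\|_2^2\le\max_{I\subseteq[m],\,|I|\ge m/2}\|A_Ix\|_2^2\le\theta_+\|x\|_2^2$$ for all $r$-sparse $x\in\mathbb{R}^N$. For non-integer $r$, order $r$ means order $\lceil r\rceil$.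
   Formalization: The denominators in c_1 and c_2 are assumed nonzero (t ≠ 1, √(t/(t−1))·δ ≠ 1, √(t(t−1)) ≠ δt); this excludes exactly equality in the condition on t, where the stated constants are undefined. *)

theory Defs
  imports "HOL-Analysis.Analysis"
begin

definition l1_norm :: "real ^ 'n \<Rightarrow> real" where
  "l1_norm x = (\<Sum>i\<in>UNIV. \<bar>x $ i\<bar>)"

definition sparse :: "nat \<Rightarrow> real ^ 'n \<Rightarrow> bool" where
  "sparse r x \<longleftrightarrow> card {i. x $ i \<noteq> 0} \<le> r"

definition sigma1 :: "nat \<Rightarrow> real ^ 'n \<Rightarrow> real" where
  "sigma1 k x = Inf {l1_norm (x - z) | z. sparse k z}"

text \<open>The infimum is a minimum, as in the usual definition of the best \<open>k\<close>-term
  approximation error.\<close>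

lemma sigma1_attained:
  fixes x :: "real ^ 'n"
  shows "\<exists>z. sparse k z \<and> sigma1 k x = l1_norm (x - z)"
    and "sparse k y \<Longrightarrow> sigma1 k x \<le> l1_norm (x - y)"
proof -
  define R :: "'n set \<Rightarrow> real ^ 'n" where "R S = (\<chi> i. if i \<in> S then x $ i else 0)" for S
  define F :: "'n set set" where "F = {S. card S \<le> k}"
  have F: "finite F" "F \<noteq> {}"
    by (auto simp: F_def intro!: exI[of _ "{}"])
  obtain S where S: "S \<in> F" "\<And>T. T \<in> F \<Longrightarrow> l1_norm (x - R S) \<le> l1_norm (x - R T)"
    using arg_min_if_finite[OF F, of "\<lambda>S. l1_norm (x - R S)"] by (meson not_le)
  have R_sparse: "sparse k (R S)"
  proof -
    have "{i. R S $ i \<noteq> 0} \<subseteq> S" by (auto simp: R_def)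
    then have "card {i. R S $ i \<noteq> 0} \<le> card S" by (intro card_mono) auto
    then show ?thesis using S(1) by (simp add: sparse_def F_def)
  qed
  have le: "l1_norm (x - R S) \<le> l1_norm (x - z)" if "sparse k z" for z
  proof -
    have "l1_norm (x - R {i. z $ i \<noteq> 0}) \<le> l1_norm (x - z)"
      unfolding l1_norm_def by (rule sum_mono) (auto simp: R_def)
    moreover have "{i. z $ i \<noteq> 0} \<in> F" using that by (simp add: F_def sparse_def)
    ultimately show ?thesis using S(2) by fastforce
  qed
  have eq: "sigma1 k x = l1_norm (x - R S)"
    unfolding sigma1_def using R_sparse le by (intro cInf_eq_minimum) auto
  show "\<exists>z. sparse k z \<and> sigma1 k x = l1_norm (x - z)" using R_sparse eq by blast
  show "sparse k y \<Longrightarrow> sigma1 k x \<le> l1_norm (x - y)" using le eq by simp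
qed

text \<open>The size of \<open>A\<^sub>I\<close> depends on \<open>I\<close> and so cannot be a type. The rows outside \<open>I\<close> are
  replaced by zero rows instead of being deleted; this changes no norm \<open>\<parallel>A\<^sub>I x\<parallel>\<^sub>2\<close>.\<close>

definition row_submatrix :: "real ^ 'n ^ 'm \<Rightarrow> 'm set \<Rightarrow> real ^ 'n ^ 'm" where
  "row_submatrix A I = (\<chi> i. if i \<in> I then row i A else 0)"

lemma norm_row_submatrix:
  "(norm (row_submatrix A I *v x))\<^sup>2 = (\<Sum>i\<in>I. (row i A \<bullet> x)\<^sup>2)"
proof -
  have "(row_submatrix A I *v x) $ i = (if i \<in> I then row i A \<bullet> x else 0)" for i
    by (simp add: row_submatrix_def matrix_vector_mul_component)
  then have "(norm (row_submatrix A I *v x))\<^sup>2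
      = (\<Sum>i\<in>UNIV. if i \<in> I then (row i A \<bullet> x)\<^sup>2 else 0)"
    unfolding power2_norm_eq_inner inner_vec_def
    by (intro sum.cong) (auto simp: power2_eq_square)
  also have "\<dots> = (\<Sum>i\<in>I. (row i A \<bullet> x)\<^sup>2)"
    by (simp add: sum.If_cases)
  finally show ?thesis .
qed

text \<open>The order \<open>r\<close> is real; it stands for \<open>\<lceil>r\<rceil>\<close>.\<close>

definition srip :: "real ^ 'n ^ 'm \<Rightarrow> real \<Rightarrow> real \<Rightarrow> real \<Rightarrow> bool" where
  "srip A r \<theta>m \<theta>p \<longleftrightarrow>
     \<theta>m \<in> {0<..<2} \<and> \<theta>p \<in> {0<..<2} \<and>
     (\<forall>x. sparse (nat \<lceil>r\<rceil>) x \<longrightarrow>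
        (let V = (\<lambda>I. (norm (row_submatrix A I *v x))\<^sup>2) ` {I. real (card I) \<ge> real CARD('m) / 2}
         in \<theta>m * (norm x)\<^sup>2 \<le> Min V \<and> Min V \<le> Max V \<and> Max V \<le> \<theta>p * (norm x)\<^sup>2))"

text \<open>Solutions of the \<open>\<ell>\<^sub>1\<close> program. On vectors, \<open>\<bar>y\<bar>\<close> is the entrywise absolute value
  (theorem \<open>abs_vec_def\<close>).\<close>

definition phaseless_l1_solution ::
    "real ^ 'n ^ 'm \<Rightarrow> real ^ 'n \<Rightarrow> real \<Rightarrow> real ^ 'n \<Rightarrow> bool" where
  "phaseless_l1_solution A x0 \<epsilon> xh \<longleftrightarrow>
     is_arg_min l1_norm (\<lambda>x. (norm (\<bar>A *v x\<bar> - \<bar>A *v x0\<bar>))\<^sup>2 \<le> \<epsilon>\<^sup>2) xh"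

end

theory Submission
  imports Defs
begin

text \<open>
  Let \<open>I\<close> be the set of rows on which \<open>A x\<^sub>0\<close> and \<open>A x*\<close> agree in sign. One of \<open>I\<close> and its
  complement contains at least half of the rows. Keeping only these rows, the constraint says
  \<open>\<parallel>B h\<parallel> \<le> \<epsilon>\<close> for \<open>h = x* - x\<^sub>0\<close> or \<open>h = x* + x\<^sub>0\<close>, and \<open>B\<close> has the usual restricted isometry
  property, so that the claim becomes the bound of Cai and Zhang for stable recovery of sparse vectors.

  Cai and Zhang write the small entries \<open>w\<close> of \<open>h\<close> as a convex combination of sparse vectors
  \<open>u\<^sub>i\<close> and average over \<open>i\<close>. With \<open>v = h - w\<close>, the averaged quantity is affine in \<open>u\<^sub>i\<close>, so a single
  sparse \<open>u\<close> with \<open>\<langle>B v, B u\<rangle> \<le> \<langle>B v, B w\<rangle>\<close> is enough. Then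
  \<open>\<langle>B v, B (v + u)\<rangle> \<le> \<langle>B v, B h\<rangle> \<le> \<parallel>B v\<parallel> \<epsilon>\<close>, and the restricted isometry property bounds the left side
  from below by polarization, which gives a quadratic inequality for \<open>\<parallel>v\<parallel>\<close>.
\<close>

section \<open>Sparse replacement under a linear functional\<close>

text \<open>Moving mass between two entries strictly between \<open>0\<close> and \<open>\<alpha>\<close> in absolute value, in the
  direction in which \<open>f\<close> does not decrease, makes one of them extreme. With at most one such entry
  left, the \<open>\<ell>\<^sub>1\<close> bound forces sparsity.\<close>

lemma ex_sparse_linear_ge:
  fixes v :: "real ^ 'n" and f :: "real ^ 'n \<Rightarrow> real"
  assumes f: "linear f" and \<alpha>: "\<alpha> > 0"
    and "\<And>i. \<bar>v $ i\<bar> \<le> \<alpha>" and "l1_norm v \<le> real s * \<alpha>"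
  shows "\<exists>u. sparse s u \<and> (\<forall>i. \<bar>u $ i\<bar> \<le> \<alpha>) \<and> (\<forall>i. v $ i = 0 \<longrightarrow> u $ i = 0) \<and> f v \<le> f u"
  using assms(3,4)
proof (induction "card {i. 0 < \<bar>v $ i\<bar> \<and> \<bar>v $ i\<bar> < \<alpha>}" arbitrary: v rule: less_induct)
  case less
  define F where "F w = {i. 0 < \<bar>w $ i\<bar> \<and> \<bar>w $ i\<bar> < \<alpha>}" for w :: "real ^ 'n"
  show ?case
  proof (cases "\<exists>i j. i \<in> F v \<and> j \<in> F v \<and> i \<noteq> j")
    case False
    define E where "E = {i. \<bar>v $ i\<bar> = \<alpha>}"
    have supp: "{i. v $ i \<noteq> 0} = E \<union> F v"
      using \<alpha> less.prems(1) by (fastforce simp: E_def F_def order.order_iff_strict)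
    have disj: "E \<inter> F v = {}" by (auto simp: E_def F_def)
    have "(\<Sum>i\<in>E \<union> F v. \<bar>v $ i\<bar>) \<le> l1_norm v"
      unfolding l1_norm_def by (rule sum_mono2) auto
    moreover have "(\<Sum>i\<in>E \<union> F v. \<bar>v $ i\<bar>) = real (card E) * \<alpha> + (\<Sum>i\<in>F v. \<bar>v $ i\<bar>)"
      using disj by (simp add: sum.union_disjoint E_def)
    ultimately have le: "real (card E) * \<alpha> + (\<Sum>i\<in>F v. \<bar>v $ i\<bar>) \<le> real s * \<alpha>"
      using less.prems(2) by linarith
    have "card E + card (F v) \<le> s"
    proof (cases "F v = {}")
      case True
      then show ?thesis using le \<alpha> by simp
    next
      \<comment> \<open>The single intermediate entry has positive mass, so strictly fewer than
        \<open>s\<close> entries have size \<open>\<alpha>\<close>; this leaves one slot for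
        it.\<close>
      case nonempty: False
      then obtain i where i: "F v = {i}" using False by blast
      then have "\<bar>v $ i\<bar> > 0" by (auto simp: F_def)
      then have "real (card E) * \<alpha> < real s * \<alpha>" using le i by simp
      then have "card E < s" using \<alpha> by simp
      then show ?thesis using i by simp
    qed
    then have "sparse s v"
      using disj by (simp add: sparse_def supp card_Un_disjoint)
    then show ?thesis using less.prems(1) by blast
  next
    case True
    \<comment> \<open>A small positive multiple of \<open>d i j\<close> moves mass from entry
      \<open>j\<close> to entry \<open>i\<close> and keeps both signs. Swapping the indices negates
      \<open>d\<close>, so one of the two orientations does not decrease \<open>f\<close>.\<close>
    define d where "d i j = axis i (sgn (v $ i)) - axis j (sgn (v $ j))" for i j
    obtain a b where ab: "a \<in> F v" "b \<in> F v" "a \<noteq> b" using True by blast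
    have "f (d b a) = - f (d a b)"
      using linear_neg[OF f, of "d a b"] by (simp add: d_def)
    then obtain i j where ij: "i \<in> F v" "j \<in> F v" "i \<noteq> j" and fd: "f (d i j) \<ge> 0"
      using ab by (metis neg_0_le_iff_le linear)
    \<comment> \<open>The longest step that neither pushes entry \<open>i\<close> beyond
      \<open>\<alpha>\<close> nor entry \<open>j\<close> through zero; one of the two limits is
      reached.\<close>
    define \<tau> where "\<tau> = min (\<alpha> - \<bar>v $ i\<bar>) \<bar>v $ j\<bar>"
    define w where "w = v + \<tau> *\<^sub>R d i j"
    have \<tau>: "\<tau> > 0" "\<tau> \<le> \<alpha> - \<bar>v $ i\<bar>" "\<tau> \<le> \<bar>v $ j\<bar>"
      using ij by (auto simp: \<tau>_def F_def)
    have wi: "\<bar>w $ i\<bar> = \<bar>v $ i\<bar> + \<tau>" and wj: "\<bar>w $ j\<bar> = \<bar>v $ j\<bar> - \<tau>"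
      using \<tau> ij by (auto simp: w_def d_def axis_def sgn_if abs_if F_def)
    have wl: "w $ l = v $ l" if "l \<noteq> i" "l \<noteq> j" for l
      using that by (auto simp: w_def d_def axis_def)
    have sub: "F w \<subseteq> F v"
    proof
      fix l assume "l \<in> F w"
      then show "l \<in> F v" using ij wl[of l] by (cases "l = i \<or> l = j") (auto simp: F_def)
    qed
    have "\<bar>w $ i\<bar> = \<alpha> \<or> \<bar>w $ j\<bar> = 0"
      using wi wj by (auto simp: \<tau>_def min_def)
    then have "i \<notin> F w \<or> j \<notin> F w" by (auto simp: F_def)
    then have "F w \<subset> F v" using sub ij by blast
    then have card: "card (F w) < card (F v)" by (intro psubset_card_mono) auto
    have "(\<Sum>l\<in>UNIV. \<bar>w $ l\<bar>)
        = (\<Sum>l\<in>UNIV. \<bar>v $ l\<bar> + ((if l = i then \<tau> else 0) - (if l = j then \<tau> else 0)))"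
      using wi wj wl ij by (intro sum.cong) auto
    also have "\<dots> = (\<Sum>l\<in>UNIV. \<bar>v $ l\<bar>)"
      by (simp add: sum.distrib sum_subtractf)
    finally have l1: "l1_norm w = l1_norm v" by (simp add: l1_norm_def)
    have bound: "\<bar>w $ l\<bar> \<le> \<alpha>" for l
      using wi wj wl[of l] \<tau> less.prems(1)[of l] less.prems(1)[of j]
      by (cases "l = i"; cases "l = j") auto
    obtain u where u: "sparse s u" "\<forall>i. \<bar>u $ i\<bar> \<le> \<alpha>" "\<forall>i. w $ i = 0 \<longrightarrow> u $ i = 0" "f w \<le> f u"
      using less.hyps[of w] card bound l1 less.prems(2) unfolding F_def by auto
    have "f w = f v + \<tau> * f (d i j)"
      by (simp add: w_def linear_add[OF f] linear_scale[OF f])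
    then have "f v \<le> f u" using u(4) fd \<tau> by (smt (verit) mult_nonneg_nonneg)
    moreover have "w $ l = 0" if "v $ l = 0" for l
      using that wl[of l] ij by (auto simp: F_def)
    ultimately show ?thesis using u by blast
  qed
qed

section \<open>Largest entries and the cone condition\<close>

text \<open>Exchange argument for a set of maximal mass: if it is full, swapping any member for
  \<open>j\<close> cannot gain; if there is room, inserting \<open>j\<close> cannot gain, so
  \<open>h $ j\<close> is zero.\<close>

lemma ex_largest_entries:
  fixes h :: "real ^ 'n"
  obtains S where "card S \<le> k" "\<And>T. card T \<le> k \<Longrightarrow> (\<Sum>i\<in>T. \<bar>h $ i\<bar>) \<le> (\<Sum>i\<in>S. \<bar>h $ i\<bar>)"
    "\<And>j. j \<notin> S \<Longrightarrow> real k * \<bar>h $ j\<bar> \<le> (\<Sum>i\<in>S. \<bar>h $ i\<bar>)"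
proof -
  define F where "F = {S :: 'n set. card S \<le> k}"
  define g where "g S = (\<Sum>i\<in>S. \<bar>h $ i\<bar>)" for S
  have F: "finite F" "F \<noteq> {}"
    by (auto simp: F_def intro!: exI[of _ "{}"])
  obtain S where S: "S \<in> F" "\<And>T. T \<in> F \<Longrightarrow> g T \<le> g S"
    using arg_min_if_finite[OF F, of "\<lambda>S. - g S"] by (meson not_le neg_less_iff_less)
  have "real k * \<bar>h $ j\<bar> \<le> g S" if j: "j \<notin> S" for j
  proof (cases "card S = k")
    case True
    have "\<bar>h $ j\<bar> \<le> \<bar>h $ i\<bar>" if i: "i \<in> S" for i
    proof -
      have "insert j (S - {i}) \<in> F"
        using i j True card_Suc_Diff1[of S i] by (simp add: F_def)
      then have "g (insert j (S - {i})) \<le> g S" by (rule S(2))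
      then show ?thesis using i j by (simp add: g_def sum_diff1)
    qed
    then show ?thesis
      using sum_mono[of S "\<lambda>_. \<bar>h $ j\<bar>" "\<lambda>i. \<bar>h $ i\<bar>"] True by (simp add: g_def)
  next
    case False
    then have "insert j S \<in> F" using S(1) j by (simp add: F_def)
    then have "g (insert j S) \<le> g S" by (rule S(2))
    then have "\<bar>h $ j\<bar> \<le> 0" using j by (simp add: g_def)
    then show ?thesis by (simp add: g_def sum_nonneg)
  qed
  with that[of S] S show thesis by (simp add: F_def g_def)
qed

text \<open>The triangle inequality on the support \<open>T\<close> of \<open>z\<close> and on its
  complement gives the bound with \<open>T\<close> in place of \<open>S\<close>. Maximality of
  \<open>S\<close> moves mass of \<open>h\<close> to the favourable side, and off \<open>T\<close>
  the vectors \<open>x\<close> and \<open>x - z\<close> agree.\<close>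

lemma l1_cone:
  fixes x h :: "real ^ 'n"
  assumes "l1_norm (x + h) \<le> l1_norm x" and "sparse k z"
    and max: "\<And>T. card T \<le> k \<Longrightarrow> (\<Sum>i\<in>T. \<bar>h $ i\<bar>) \<le> (\<Sum>i\<in>S. \<bar>h $ i\<bar>)"
  shows "(\<Sum>i\<in>-S. \<bar>h $ i\<bar>) \<le> (\<Sum>i\<in>S. \<bar>h $ i\<bar>) + 2 * l1_norm (x - z)"
proof -
  define T where "T = {i. z $ i \<noteq> 0}"
  have split: "l1_norm y = (\<Sum>i\<in>U. \<bar>y $ i\<bar>) + (\<Sum>i\<in>-U. \<bar>y $ i\<bar>)" for U and y :: "real ^ 'n"
    unfolding l1_norm_def using sum.subset_diff[of U UNIV "\<lambda>i. \<bar>y $ i\<bar>"]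
    by (simp add: Compl_eq_Diff_UNIV)
  have "(\<Sum>i\<in>-T. \<bar>x $ i\<bar>) \<le> l1_norm (x - z)"
    by (subst split[of _ T]) (auto simp: T_def intro!: add_increasing sum_nonneg sum_mono)
  moreover have "(\<Sum>i\<in>T. \<bar>x $ i\<bar>) - (\<Sum>i\<in>T. \<bar>h $ i\<bar>) \<le> (\<Sum>i\<in>T. \<bar>(x + h) $ i\<bar>)"
    by (subst sum_subtractf[symmetric], rule sum_mono) auto
  moreover have "(\<Sum>i\<in>-T. \<bar>h $ i\<bar>) - (\<Sum>i\<in>-T. \<bar>x $ i\<bar>) \<le> (\<Sum>i\<in>-T. \<bar>(x + h) $ i\<bar>)"
    by (subst sum_subtractf[symmetric], rule sum_mono) auto
  moreover have "(\<Sum>i\<in>T. \<bar>h $ i\<bar>) \<le> (\<Sum>i\<in>S. \<bar>h $ i\<bar>)"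
    using assms(2) by (intro max) (simp add: T_def sparse_def)
  ultimately show ?thesis
    using assms(1) split[of x T] split[of "x + h" T] split[of h T] split[of h S] by linarith
qed

section \<open>Restriction to coordinates and reduction to half of the rows\<close>

definition restrict_vec :: "'n set \<Rightarrow> real ^ 'n \<Rightarrow> real ^ 'n" where
  "restrict_vec S x = (\<chi> i. if i \<in> S then x $ i else 0)"

lemma restrict_vec_nth [simp]: "restrict_vec S x $ i = (if i \<in> S then x $ i else 0)"
  by (simp add: restrict_vec_def)

lemma norm_sq_vec: "(norm (x :: real ^ 'n))\<^sup>2 = (\<Sum>i\<in>UNIV. (x $ i)\<^sup>2)"
  by (simp only: power2_norm_eq_inner inner_vec_def) (simp add: power2_eq_square)

lemma norm_restrict_vec_sq: "(norm (restrict_vec S x))\<^sup>2 = (\<Sum>i\<in>S. (x $ i)\<^sup>2)"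
  by (simp add: norm_sq_vec sum.If_cases if_distrib[of "\<lambda>y. y\<^sup>2"] cong: if_cong)

text \<open>For reals \<open>a\<close>, \<open>b\<close> the distance of their absolute values is
  that of \<open>a\<close> and \<open>b\<close> if \<open>a * b\<close> is nonnegative, and that of
  \<open>a\<close> and \<open>- b\<close> otherwise. Dropping rows only decreases the
  residual.\<close>

lemma abs_minus_or_plus_vec:
  fixes A :: "real ^ 'n ^ 'm"
  assumes "(norm (\<bar>A *v x\<bar> - \<bar>A *v y\<bar>))\<^sup>2 \<le> \<epsilon>\<^sup>2" and "\<epsilon> \<ge> 0"
  obtains I h where "real (card I) \<ge> real CARD('m) / 2" "h = x - y \<or> h = x + y"
    "norm (row_submatrix A I *v h) \<le> \<epsilon>"
proof -
  define I where "I = {i. (row i A \<bullet> x) * (row i A \<bullet> y) \<ge> 0}"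
  have comp: "(A *v w) $ i = row i A \<bullet> w" for w i
    by (simp add: matrix_vector_mul_component row_def)
  have le: "norm (row_submatrix A J *v h) \<le> \<epsilon>"
    if J: "\<And>i. i \<in> J \<Longrightarrow> \<bar>row i A \<bullet> h\<bar> = \<bar>\<bar>row i A \<bullet> x\<bar> - \<bar>row i A \<bullet> y\<bar>\<bar>" for J h
  proof -
    have "(norm (row_submatrix A J *v h))\<^sup>2 = (\<Sum>i\<in>J. (\<bar>row i A \<bullet> x\<bar> - \<bar>row i A \<bullet> y\<bar>)\<^sup>2)"
      unfolding norm_row_submatrix by (intro sum.cong refl) (metis J power2_abs)
    also have "\<dots> \<le> (\<Sum>i\<in>UNIV. (\<bar>row i A \<bullet> x\<bar> - \<bar>row i A \<bullet> y\<bar>)\<^sup>2)"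
      by (rule sum_mono2) auto
    also have "\<dots> = (norm (\<bar>A *v x\<bar> - \<bar>A *v y\<bar>))\<^sup>2"
      by (simp add: norm_sq_vec comp abs_vec_def)
    finally show ?thesis using assms by (meson order_trans power2_le_imp_le)
  qed
  have "card I + card (- I) = CARD('m)"
    by (metis card_Un_disjoint Compl_disjoint Compl_partition finite)
  then consider "real (card I) \<ge> real CARD('m) / 2" | "real (card (- I)) \<ge> real CARD('m) / 2"
    by linarith
  then show thesis
  proof cases
    case 1
    have "norm (row_submatrix A I *v (x - y)) \<le> \<epsilon>"
      by (rule le) (auto simp: I_def inner_diff_right zero_le_mult_iff)
    then show ?thesis using 1 that by blast
  next
    case 2
    have "norm (row_submatrix A (- I) *v (x + y)) \<le> \<epsilon>"
      by (rule le) (auto simp: I_def inner_add_right not_le mult_less_0_iff)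
    then show ?thesis using 2 that by blast
  qed
qed

lemma sripD:
  fixes A :: "real ^ 'n ^ 'm"
  assumes "srip A r \<theta>m \<theta>p" "sparse (nat \<lceil>r\<rceil>) x" "real (card I) \<ge> real CARD('m) / 2"
  shows "\<theta>m * (norm x)\<^sup>2 \<le> (norm (row_submatrix A I *v x))\<^sup>2"
    and "(norm (row_submatrix A I *v x))\<^sup>2 \<le> \<theta>p * (norm x)\<^sup>2"
proof -
  let ?V = "(\<lambda>I. (norm (row_submatrix A I *v x))\<^sup>2) ` {I. real (card I) \<ge> real CARD('m) / 2}"
  have "\<theta>m * (norm x)\<^sup>2 \<le> Min ?V" "Max ?V \<le> \<theta>p * (norm x)\<^sup>2"
    using assms(1,2) by (auto simp: srip_def Let_def)
  moreover have "finite ?V" "(norm (row_submatrix A I *v x))\<^sup>2 \<in> ?V"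
    using assms(3) by auto
  ultimately show "\<theta>m * (norm x)\<^sup>2 \<le> (norm (row_submatrix A I *v x))\<^sup>2"
    and "(norm (row_submatrix A I *v x))\<^sup>2 \<le> \<theta>p * (norm x)\<^sup>2"
    by (meson Min_le Max_ge order_trans)+
qed


section \<open>Sparse substitutes for the tail\<close>

text \<open>Each tail entry above the threshold \<open>L / n\<close> goes into \<open>W\<close> and
  uses up more than one share of the mass \<open>L\<close>, so the rest has mass at most
  \<open>n - card W\<close> shares and \<open>ex_sparse_linear_ge\<close> applies. \<open>W\<close>
  is fixed before \<open>f\<close> because the functional used later depends on
  \<open>W\<close>.\<close>

lemma ex_sparse_tail_ge:
  fixes h :: "real ^ 'n"
  assumes tail: "(\<Sum>i\<in>-S. \<bar>h $ i\<bar>) \<le> L" and "L > 0" and "n > 0"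
  obtains W where "W \<inter> S = {}" "card W \<le> n"
    "\<And>f :: real ^ 'n \<Rightarrow> real. linear f \<Longrightarrow> \<exists>u. sparse (n - card W) u \<and> (\<forall>i\<in>S \<union> W. u $ i = 0) \<and>
       (norm u)\<^sup>2 \<le> L\<^sup>2 / real n \<and> f (h - restrict_vec (S \<union> W) h) \<le> f u"
proof -
  define \<gamma> where "\<gamma> = L / real n"
  have \<gamma>: "\<gamma> > 0" "L = real n * \<gamma>" using assms by (auto simp: \<gamma>_def)
  define W where "W = {i \<in> -S. \<bar>h $ i\<bar> > \<gamma>}"
  define w where "w = h - restrict_vec (S \<union> W) h"
  have WS: "W \<inter> S = {}" by (auto simp: W_def)
  have "(\<Sum>i\<in>W. \<bar>h $ i\<bar>) + (\<Sum>i\<in>-S - W. \<bar>h $ i\<bar>) = (\<Sum>i\<in>-S. \<bar>h $ i\<bar>)"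
    using sum.subset_diff[of W "-S" "\<lambda>i. \<bar>h $ i\<bar>"] WS by (simp add: disjoint_eq_subset_Compl)
  moreover have "real (card W) * \<gamma> \<le> (\<Sum>i\<in>W. \<bar>h $ i\<bar>)"
    using sum_mono[of W "\<lambda>_. \<gamma>" "\<lambda>i. \<bar>h $ i\<bar>"] by (simp add: W_def)
  moreover have "l1_norm w = (\<Sum>i\<in>-S - W. \<bar>h $ i\<bar>)"
    unfolding l1_norm_def by (rule sum.mono_neutral_cong_right) (auto simp: w_def)
  ultimately have sum: "real (card W) * \<gamma> + l1_norm w \<le> real n * \<gamma>"
    using tail \<gamma> by linarith
  have "l1_norm w \<ge> 0" by (simp add: l1_norm_def sum_nonneg)
  then have "real (card W) * \<gamma> \<le> real n * \<gamma>" using sum by linarith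
  then have card: "card W \<le> n" using \<gamma> by simp
  have l1: "l1_norm w \<le> real (n - card W) * \<gamma>"
    using sum card by (simp add: of_nat_diff algebra_simps)
  have w_le: "\<bar>w $ i\<bar> \<le> \<gamma>" for i
    using \<gamma> by (auto simp: w_def W_def)
  have "\<exists>u. sparse (n - card W) u \<and> (\<forall>i\<in>S \<union> W. u $ i = 0) \<and>
       (norm u)\<^sup>2 \<le> L\<^sup>2 / real n \<and> f w \<le> f u" if "linear f"
    for f :: "real ^ 'n \<Rightarrow> real"
  proof -
    obtain u where u: "sparse (n - card W) u" "\<forall>i. \<bar>u $ i\<bar> \<le> \<gamma>"
        "\<forall>i. w $ i = 0 \<longrightarrow> u $ i = 0" "f w \<le> f u"
      using ex_sparse_linear_ge[OF \<open>linear f\<close> \<gamma>(1) w_le l1] by blast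
    have "(norm u)\<^sup>2 = (\<Sum>i | u $ i \<noteq> 0. (u $ i)\<^sup>2)"
      unfolding norm_sq_vec by (rule sum.mono_neutral_right) auto
    also have "\<dots> \<le> (\<Sum>i | u $ i \<noteq> 0. \<gamma>\<^sup>2)"
      using u(2) by (intro sum_mono) (simp add: abs_le_square_iff[symmetric] order_less_imp_le[OF \<gamma>(1)])
    also have "\<dots> \<le> real n * \<gamma>\<^sup>2"
      using u(1) by (auto simp: sparse_def intro!: mult_right_mono)
    also have "\<dots> = L\<^sup>2 / real n"
      using assms(3) by (simp add: \<gamma>_def power2_eq_square)
    finally show ?thesis using u by (auto simp: w_def)
  qed
  then show thesis using that[OF WS card] by (simp add: w_def)
qed

section \<open>Stable recovery from the restricted isometry property\<close>

text \<open>The bound dominates the larger root of the quadratic, by subadditivity of the square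
  root. For larger \<open>X\<close> both \<open>g * X\<close> and \<open>g * X - b\<close> exceed
  \<open>q\<close>, which contradicts the assumption.\<close>

lemma le_of_quadratic_le:
  fixes g b c P X :: real
  assumes "g * X\<^sup>2 \<le> b * X + c * P\<^sup>2 / 2" and "g > 0" "b \<ge> 0" "c \<ge> 0" "P \<ge> 0"
  shows "X \<le> b / g + sqrt (2 * g * c) / (2 * g) * P"
proof (rule ccontr)
  define q where "q = sqrt (2 * g * c) / 2 * P"
  have q: "q \<ge> 0" "q\<^sup>2 = g * (c * P\<^sup>2 / 2)"
    using assms by (auto simp: q_def power_mult_distrib power_divide)
  assume "\<not> ?thesis"
  then have "b / g + q / g < X" by (simp add: q_def)
  then have gX: "b + q < g * X" using \<open>g > 0\<close> by (simp add: field_simps)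
  have "q * q < (g * X) * (g * X - b)"
    using gX q(1) assms by (intro mult_strict_mono') auto
  also have "\<dots> = g * (g * X\<^sup>2 - b * X)" by (simp add: algebra_simps power2_eq_square)
  also have "\<dots> \<le> g * (c * P\<^sup>2 / 2)" using assms by (intro mult_left_mono) auto
  finally show False using q(2) by (simp add: power2_eq_square)
qed

text \<open>Polarization: the vectors \<open>v/2 + \<mu>u/2\<close> and
  \<open>(1/2 - \<mu>)v - \<mu>u/2\<close> have difference \<open>\<mu>(v + u)\<close> and sum
  \<open>(1 - \<mu>)v\<close>. The lower isometry bound is used for the first and the upper one for
  the second; \<open>\<mu>\<close> stays free to be optimized.\<close>

lemma inner_ge_of_rip:
  fixes B :: "real ^ 'n ^ 'm"
  assumes rip: "\<And>a b. (1 - \<delta>) * (norm (a *\<^sub>R v + b *\<^sub>R u))\<^sup>2 \<le> (norm (B *v (a *\<^sub>R v + b *\<^sub>R u)))\<^sup>2"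
      "\<And>a b. (norm (B *v (a *\<^sub>R v + b *\<^sub>R u)))\<^sup>2 \<le> (1 + \<delta>) * (norm (a *\<^sub>R v + b *\<^sub>R u))\<^sup>2"
    and orth: "v \<bullet> u = 0"
  shows "(\<mu> * (1 - \<mu>) - \<delta> * (1/2 - \<mu> + \<mu>\<^sup>2)) * (norm v)\<^sup>2 - \<delta> * \<mu>\<^sup>2 * (norm u)\<^sup>2 / 2
    \<le> \<mu> * (1 - \<mu>) * ((B *v v) \<bullet> (B *v (v + u)))"
proof -
  have pyth: "(norm (a *\<^sub>R v + b *\<^sub>R u))\<^sup>2 = a\<^sup>2 * (norm v)\<^sup>2 + b\<^sup>2 * (norm u)\<^sup>2" for a b
    using orth unfolding power2_norm_eq_inner
    by (simp add: inner_add_left inner_add_right inner_commute power2_eq_square)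
  have B: "(norm (B *v (a *\<^sub>R v + b *\<^sub>R u)))\<^sup>2
      = a\<^sup>2 * (norm (B *v v))\<^sup>2 + 2 * a * b * ((B *v v) \<bullet> (B *v u)) + b\<^sup>2 * (norm (B *v u))\<^sup>2" for a b
    unfolding power2_norm_eq_inner matrix_vector_right_distrib matrix_vector_mult_scaleR
    by (simp add: inner_add_left inner_add_right inner_commute[of "B *v u" "B *v v"] power2_eq_square algebra_simps)
  have inner: "(B *v v) \<bullet> (B *v (v + u)) = (norm (B *v v))\<^sup>2 + (B *v v) \<bullet> (B *v u)"
    by (simp add: matrix_vector_right_distrib inner_add_right power2_norm_eq_inner)
  have "\<mu> * (1 - \<mu>) * ((B *v v) \<bullet> (B *v (v + u)))
      = (norm (B *v ((1/2) *\<^sub>R v + (\<mu>/2) *\<^sub>R u)))\<^sup>2 - (norm (B *v ((1/2 - \<mu>) *\<^sub>R v + (-\<mu>/2) *\<^sub>R u)))\<^sup>2"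
    unfolding B inner by (simp add: power2_eq_square field_simps)
  also have "\<dots> \<ge> (1 - \<delta>) * (norm ((1/2) *\<^sub>R v + (\<mu>/2) *\<^sub>R u))\<^sup>2
      - (1 + \<delta>) * (norm ((1/2 - \<mu>) *\<^sub>R v + (-\<mu>/2) *\<^sub>R u))\<^sup>2"
    by (intro diff_mono rip)
  finally show ?thesis
    unfolding pyth by (simp add: field_simps power2_eq_square)
qed

text \<open>With \<open>a\<close>, \<open>P\<close>, \<open>M\<close> as in the proof,
  Cauchy-Schwarz bounds \<open>M\<close> by \<open>sqrt k * a\<close>. Entries off \<open>S\<close>
  are at most \<open>M / k\<close>, so their squares sum to at most \<open>a * (a + P)\<close>;
  enlarging the cross term then completes a square.\<close>

lemma norm_le_of_dominating_set:
  fixes h :: "real ^ 'n"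
  assumes "k \<ge> 1" and \<sigma>: "\<sigma> \<ge> 0" and S: "card S \<le> k"
    and tail: "\<And>j. j \<notin> S \<Longrightarrow> real k * \<bar>h $ j\<bar> \<le> (\<Sum>i\<in>S. \<bar>h $ i\<bar>)"
    and cone: "(\<Sum>i\<in>-S. \<bar>h $ i\<bar>) \<le> (\<Sum>i\<in>S. \<bar>h $ i\<bar>) + \<sigma>"
  shows "(\<Sum>i\<in>S. \<bar>h $ i\<bar>) \<le> sqrt (real k) * norm (restrict_vec S h)"
    and "norm h \<le> sqrt 2 * norm (restrict_vec S h) + \<sigma> / sqrt (real k)"
proof -
  define a where "a = norm (restrict_vec S h)"
  define P where "P = \<sigma> / sqrt (real k)"
  define M where "M = (\<Sum>i\<in>S. \<bar>h $ i\<bar>)"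
  have k: "real k > 0" using assms(1) by simp
  have nonneg: "a \<ge> 0" "P \<ge> 0" "M \<ge> 0"
    using \<sigma> by (auto simp: a_def P_def M_def sum_nonneg)
  have a2: "a\<^sup>2 = (\<Sum>i\<in>S. (h $ i)\<^sup>2)" by (simp add: a_def norm_restrict_vec_sq)
  have "M\<^sup>2 \<le> a\<^sup>2 * real (card S)"
    using sum_squared_le_sum_of_squares[of "\<lambda>i. \<bar>h $ i\<bar>" S] by (simp add: M_def a2)
  also have "\<dots> \<le> a\<^sup>2 * real k" using S by (intro mult_left_mono) auto
  also have "\<dots> = (sqrt (real k) * a)\<^sup>2" by (simp add: power_mult_distrib)
  finally have M: "M \<le> sqrt (real k) * a"
    by (rule power2_le_imp_le) (use nonneg in auto)
  then show "(\<Sum>i\<in>S. \<bar>h $ i\<bar>) \<le> sqrt (real k) * norm (restrict_vec S h)"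
    by (simp add: M_def a_def)
  have \<sigma>P: "\<sigma> = sqrt (real k) * P" using k by (simp add: P_def)
  have "(\<Sum>i\<in>-S. (h $ i)\<^sup>2) \<le> (\<Sum>i\<in>-S. M / real k * \<bar>h $ i\<bar>)"
  proof (rule sum_mono)
    fix i assume "i \<in> - S"
    then have "\<bar>h $ i\<bar> \<le> M / real k" using tail[of i] k by (simp add: M_def field_simps)
    then have "\<bar>h $ i\<bar> * \<bar>h $ i\<bar> \<le> M / real k * \<bar>h $ i\<bar>" by (rule mult_right_mono) simp
    then show "(h $ i)\<^sup>2 \<le> M / real k * \<bar>h $ i\<bar>" by (simp add: power2_eq_square)
  qed
  also have "\<dots> = M * (\<Sum>i\<in>-S. \<bar>h $ i\<bar>) / real k" by (simp add: sum_distrib_left sum_divide_distrib)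
  also have "\<dots> \<le> (sqrt (real k) * a) * (sqrt (real k) * a + sqrt (real k) * P) / real k"
    using cone M nonneg unfolding M_def[symmetric] \<sigma>P
    by (intro divide_right_mono mult_mono) (auto intro: sum_nonneg)
  also have "\<dots> = a * (a + P)" using k by (simp add: field_simps)
  finally have "(\<Sum>i\<in>-S. (h $ i)\<^sup>2) \<le> a * (a + P)" .
  moreover have "(norm h)\<^sup>2 = a\<^sup>2 + (\<Sum>i\<in>-S. (h $ i)\<^sup>2)"
    unfolding norm_sq_vec a2 using sum.subset_diff[of S UNIV "\<lambda>i. (h $ i)\<^sup>2"]
    by (simp add: Compl_eq_Diff_UNIV)
  ultimately have "(norm h)\<^sup>2 \<le> 2 * a\<^sup>2 + a * P" by (simp add: power2_eq_square algebra_simps)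
  also have "\<dots> \<le> 2 * a\<^sup>2 + 2 * sqrt 2 * (a * P) + P\<^sup>2"
  proof -
    have "1 * (a * P) \<le> 2 * sqrt 2 * (a * P)"
      using nonneg real_sqrt_ge_1_iff[of 2] by (intro mult_right_mono) (auto simp del: real_sqrt_ge_1_iff)
    then show ?thesis by (simp add: add_increasing2)
  qed
  also have "\<dots> = (sqrt 2 * a + P)\<^sup>2" by (simp add: power2_sum power_mult_distrib)
  finally have "norm h \<le> sqrt 2 * a + P"
    by (rule power2_le_imp_le) (use nonneg in auto)
  then show "norm h \<le> sqrt 2 * norm (restrict_vec S h) + \<sigma> / sqrt (real k)"
    by (simp add: a_def P_def)
qed


text \<open>Here \<open>g\<close> is the leading coefficient of the quadratic inequality for
  \<open>norm v\<close> after cancelling \<open>1 - 2 * \<mu>\<close>. The outer factor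
  \<open>sqrt 2\<close> and the last \<open>P\<close> come from passing from
  \<open>restrict_vec S h\<close> to \<open>h\<close>.\<close>

lemma norm_le_of_rip_cone:
  fixes B :: "real ^ 'n ^ 'm" and h :: "real ^ 'n"
  assumes k: "k \<ge> 1" and t: "t > 1" and K: "t * real k \<le> real K"
    and \<delta>: "\<delta> \<ge> 0" and gap: "\<delta> * t < sqrt (t * (t - 1))"
    and rip: "\<And>x. sparse K x \<Longrightarrow> (1 - \<delta>) * (norm x)\<^sup>2 \<le> (norm (B *v x))\<^sup>2"
      "\<And>x. sparse K x \<Longrightarrow> (norm (B *v x))\<^sup>2 \<le> (1 + \<delta>) * (norm x)\<^sup>2"
    and Bh: "norm (B *v h) \<le> \<epsilon>" and \<sigma>: "\<sigma> \<ge> 0" and S: "card S \<le> k"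
    and tail: "\<And>j. j \<notin> S \<Longrightarrow> real k * \<bar>h $ j\<bar> \<le> (\<Sum>i\<in>S. \<bar>h $ i\<bar>)"
    and cone: "(\<Sum>i\<in>-S. \<bar>h $ i\<bar>) \<le> (\<Sum>i\<in>S. \<bar>h $ i\<bar>) + \<sigma>"
  defines "s \<equiv> sqrt (t * (t - 1))" and "P \<equiv> \<sigma> / sqrt (real k)"
  defines "g \<equiv> s - \<delta> * t"
  shows "norm h \<le> sqrt 2 * ((s * sqrt (1 + \<delta>) * \<epsilon> + \<delta> * P) / g + sqrt (2 * g * \<delta>) / (2 * g) * P) + P"
    (is "_ \<le> sqrt 2 * ?R + P")
proof -
  have k0: "real k > 0" using k by simp
  have P: "P \<ge> 0" using \<sigma> by (simp add: P_def)
  have \<epsilon>: "\<epsilon> \<ge> 0" using Bh norm_ge_zero order_trans by blast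
  have g: "g > 0" using gap by (simp add: g_def s_def)
  have s2: "s\<^sup>2 = t * (t - 1)" and s0: "s \<ge> 0" using t by (auto simp: s_def)
  define e where "e = sqrt (1 + \<delta>) * \<epsilon>"
  have e: "e \<ge> 0" using \<epsilon> \<delta> by (simp add: e_def)
  \<comment> \<open>The sparsity budget \<open>K\<close> is split: at most \<open>k\<close> entries
    for \<open>S\<close>, and \<open>n\<close> for \<open>W\<close> and the support of
    \<open>u\<close> together.\<close>
  define n where "n = K - k"
  have "1 * real k < t * real k" using t k0 by (intro mult_strict_right_mono) auto
  then have Kk: "K > k" using K by linarith
  then have n: "n > 0" "k + n = K" by (auto simp: n_def)
  have n_ge: "real n \<ge> (t - 1) * real k" using K Kk by (simp add: n_def of_nat_diff algebra_simps)
  define a where "a = norm (restrict_vec S h)"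
  define L where "L = (\<Sum>i\<in>S. \<bar>h $ i\<bar>) + \<sigma>"
  have top: "(\<Sum>i\<in>S. \<bar>h $ i\<bar>) \<le> sqrt (real k) * a" and h_le: "norm h \<le> sqrt 2 * a + P"
    using norm_le_of_dominating_set[OF k \<sigma> S tail cone] by (auto simp: a_def P_def)
  have "\<sigma> = sqrt (real k) * P" using k0 by (simp add: P_def)
  then have L_le: "L \<le> sqrt (real k) * (a + P)" using top by (simp add: L_def algebra_simps)
  have "a \<le> ?R"
  \<comment> \<open>The threshold in \<open>ex_sparse_tail_ge\<close> must be positive. Otherwise
    \<open>h\<close> vanishes on \<open>S\<close> and \<open>a = 0\<close>.\<close>
  proof (cases "L > 0")
    case False
    moreover have "(\<Sum>i\<in>S. \<bar>h $ i\<bar>) \<ge> 0" by (simp add: sum_nonneg)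
    ultimately have "(\<Sum>i\<in>S. \<bar>h $ i\<bar>) = 0" using \<sigma> unfolding L_def by linarith
    then have "\<forall>i\<in>S. h $ i = 0" by (subst (asm) sum_nonneg_eq_0_iff) auto
    then have "restrict_vec S h = 0" by (simp add: vec_eq_iff)
    then show ?thesis using P g \<delta> s0 \<epsilon> by (simp add: a_def)
  next
    case True
    obtain W where W: "W \<inter> S = {}" "card W \<le> n" and ex_u:
      "\<And>f :: real ^ 'n \<Rightarrow> real. linear f \<Longrightarrow> \<exists>u. sparse (n - card W) u \<and> (\<forall>i\<in>S \<union> W. u $ i = 0) \<and>
         (norm u)\<^sup>2 \<le> L\<^sup>2 / real n \<and> f (h - restrict_vec (S \<union> W) h) \<le> f u"
      using ex_sparse_tail_ge[OF cone[folded L_def] True n(1)] by metis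
    define v where "v = restrict_vec (S \<union> W) h"
    define X where "X = norm v"
    define p where "p = B *v v"
    \<comment> \<open>The sign is reversed because an upper bound on the inner product with
      \<open>B *v u\<close> is wanted.\<close>
    have "linear (\<lambda>u. - (p \<bullet> (B *v u)))"
      by (intro linearI) (auto simp: matrix_vector_right_distrib matrix_vector_mult_scaleR inner_add_right)
    from ex_u[OF this] obtain u where u: "sparse (n - card W) u" "\<forall>i\<in>S \<union> W. u $ i = 0"
      "(norm u)\<^sup>2 \<le> L\<^sup>2 / real n" "p \<bullet> (B *v u) \<le> p \<bullet> (B *v (h - v))"
      unfolding v_def by auto
    have sparse: "sparse K (b *\<^sub>R v + c *\<^sub>R u)" for b c
    proof -
      have "card {i. (b *\<^sub>R v + c *\<^sub>R u) $ i \<noteq> 0} \<le> card (S \<union> W \<union> {i. u $ i \<noteq> 0})"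
        by (rule card_mono) (auto simp: v_def)
      also have "\<dots> \<le> card S + card W + card {i. u $ i \<noteq> 0}"
        by (meson add_le_mono1 card_Un_le order_trans)
      also have "\<dots> \<le> K" using S W u(1) n by (simp add: sparse_def)
      finally show ?thesis by (simp add: sparse_def)
    qed
    have "a\<^sup>2 \<le> X\<^sup>2"
      unfolding a_def X_def v_def norm_restrict_vec_sq by (rule sum_mono2) auto
    \<comment> \<open>This lets the bound on \<open>L\<close>, and hence on \<open>u\<close>, be
      expressed through \<open>X\<close> instead of \<open>a\<close>.\<close>
    then have aX: "a \<le> X" by (rule power2_le_imp_le) (simp add: X_def)
    have "L\<^sup>2 \<le> (sqrt (real k) * (X + P))\<^sup>2"
      using L_le aX True k0 by (intro power_mono) (auto intro: order_trans mult_left_mono)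
    also have "\<dots> = real k * (X + P)\<^sup>2" by (simp add: power_mult_distrib)
    finally have "L\<^sup>2 / real n \<le> real k * (X + P)\<^sup>2 / ((t - 1) * real k)"
      using n_ge t k0 by (intro frac_le) auto
    then have U: "(norm u)\<^sup>2 \<le> (X + P)\<^sup>2 / (t - 1)" using u(3) k0 by simp
    have "(norm p)\<^sup>2 \<le> (sqrt (1 + \<delta>) * X)\<^sup>2"
      using rip(2)[OF sparse[of 1 0]] \<delta> by (simp add: p_def X_def power_mult_distrib)
    then have p: "norm p \<le> sqrt (1 + \<delta>) * X"
      by (rule power2_le_imp_le) (use \<delta> in \<open>auto simp: X_def\<close>)
    have "p \<bullet> (B *v (v + u)) \<le> p \<bullet> (B *v h)"
      using u(4) by (simp add: matrix_vector_right_distrib matrix_vector_mult_diff_distrib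
          inner_add_right inner_diff_right p_def)
    also have "\<dots> \<le> norm p * norm (B *v h)" by (rule norm_cauchy_schwarz)
    also have "\<dots> \<le> (sqrt (1 + \<delta>) * X) * \<epsilon>"
      using p Bh by (intro mult_mono) (auto simp: X_def \<delta>)
    finally have upper: "p \<bullet> (B *v (v + u)) \<le> e * X" by (simp add: e_def mult_ac)
    \<comment> \<open>the \<open>\<mu>\<close> for which all terms of the next inequality share the factor \<open>1 - 2 * \<mu>\<close>\<close>
    define \<mu> where "\<mu> = s - (t - 1)"
    define c where "c = 1 - 2 * \<mu>"
    have "s\<^sup>2 < (t - 1/2)\<^sup>2" unfolding s2 by (simp add: power2_eq_square algebra_simps)
    then have "s < t - 1/2" by (rule power2_less_imp_less) (use t in simp)
    then have c: "c > 0" by (simp add: c_def \<mu>_def)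
    \<comment> \<open>These identities hold because \<open>\<mu>\<close> is the positive root of
      \<open>\<mu>\<^sup>2 = (1 - 2 * \<mu>) * (t - 1)\<close>.\<close>
    have \<mu>1: "\<mu> * (1 - \<mu>) = c * s" and \<mu>2: "\<mu>\<^sup>2 = c * (t - 1)"
      and \<mu>3: "1/2 - \<mu> + \<mu>\<^sup>2 = c * t - c / 2"
      using s2 unfolding c_def \<mu>_def by (auto simp: power2_eq_square field_simps)
    have "v \<bullet> u = 0"
      using u(2) unfolding inner_vec_def by (intro sum.neutral) (auto simp: v_def)
    then have "(\<mu> * (1 - \<mu>) - \<delta> * (1/2 - \<mu> + \<mu>\<^sup>2)) * X\<^sup>2 - \<delta> * \<mu>\<^sup>2 * (norm u)\<^sup>2 / 2
        \<le> \<mu> * (1 - \<mu>) * (p \<bullet> (B *v (v + u)))"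
      unfolding X_def p_def by (intro inner_ge_of_rip rip sparse)
    also have "\<dots> \<le> c * s * (e * X)"
      unfolding \<mu>1 using upper c s0 by (intro mult_left_mono) auto
    finally have lower: "(c * s - \<delta> * (c * t - c / 2)) * X\<^sup>2 - \<delta> * (c * (t - 1)) * (norm u)\<^sup>2 / 2 \<le> c * s * (e * X)"
      unfolding \<mu>1 \<mu>3 unfolding \<mu>2 .
    \<comment> \<open>Inserting the bound on \<open>u\<close> costs another
      \<open>\<delta> * c / 2 * X\<^sup>2\<close>, which cancels the \<open>c / 2\<close> in
      \<open>lower\<close> and leaves the coefficient \<open>c * g\<close>.\<close>
    have "(t - 1) * (norm u)\<^sup>2 \<le> (X + P)\<^sup>2" using U t by (simp add: field_simps)
    then have "(\<delta> * c / 2) * ((t - 1) * (norm u)\<^sup>2) \<le> (\<delta> * c / 2) * (X + P)\<^sup>2"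
      using \<delta> c by (intro mult_left_mono) auto
    moreover have "c * (g * X\<^sup>2) = (c * s - \<delta> * (c * t - c / 2)) * X\<^sup>2 - \<delta> * c / 2 * X\<^sup>2"
      by (simp add: g_def field_simps)
    moreover have "c * ((s * e + \<delta> * P) * X + \<delta> * P\<^sup>2 / 2)
        = c * s * (e * X) + \<delta> * c / 2 * (X + P)\<^sup>2 - \<delta> * c / 2 * X\<^sup>2"
      by (simp add: power2_eq_square field_simps)
    moreover have "\<delta> * (c * (t - 1)) * (norm u)\<^sup>2 / 2 = \<delta> * c / 2 * ((t - 1) * (norm u)\<^sup>2)"
      by simp
    ultimately have "c * (g * X\<^sup>2) \<le> c * ((s * e + \<delta> * P) * X + \<delta> * P\<^sup>2 / 2)"
      using lower by linarith
    then have "g * X\<^sup>2 \<le> (s * e + \<delta> * P) * X + \<delta> * P\<^sup>2 / 2" using c by simp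
    then have "X \<le> (s * e + \<delta> * P) / g + sqrt (2 * g * \<delta>) / (2 * g) * P"
      using g s0 e \<delta> P by (intro le_of_quadratic_le) auto
    then show ?thesis using aX by (simp add: e_def mult_ac)
  qed
  then have "sqrt 2 * a \<le> sqrt 2 * ?R" by (rule mult_left_mono) simp
  with h_le show ?thesis by linarith
qed

section \<open>Phaseless recovery from the strong restricted isometry property\<close>

theorem theorem3p1:
  fixes A :: "real ^ 'n ^ 'm"
    and x0 xh :: "real ^ 'n"
    and k :: nat
    and t \<theta>m \<theta>p \<epsilon> \<delta> c1 c2 :: real
  assumes "k \<ge> 1"
    and "\<theta>m \<in> {0<..<2}" and "\<theta>p \<in> {0<..<2}"
    and "srip A (t * real k) \<theta>m \<theta>p"
    and "t \<ge> max (1 / (2 * \<theta>m - \<theta>m\<^sup>2)) (1 / (2 * \<theta>p - \<theta>p\<^sup>2))"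
    and "\<epsilon> \<ge> 0"
    and "phaseless_l1_solution A x0 \<epsilon> xh"
    and "\<delta> = max (1 - \<theta>m) (\<theta>p - 1)"
    \<comment> \<open>the denominators occurring in \<open>c1\<close> and \<open>c2\<close> do not vanish\<close>
    and "t - 1 \<noteq> 0"
    and "1 - sqrt (t / (t - 1)) * \<delta> \<noteq> 0"
    and "sqrt (t * (t - 1)) - \<delta> * t \<noteq> 0"
    and "c1 = sqrt (2 * (1 + \<delta>)) / (1 - sqrt (t / (t - 1)) * \<delta>)"
    and "c2 = (sqrt 2 * \<delta> + sqrt ((sqrt (t * (t - 1)) - \<delta> * t) * \<delta>))
                / (sqrt (t * (t - 1)) - \<delta> * t) + 1"
  shows "min (norm (xh - x0)) (norm (xh + x0))
           \<le> c1 * \<epsilon> + c2 * (2 * sigma1 k x0 / sqrt (real k))"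
proof -
  \<comment> \<open>Since
    \<open>2 * \<theta> - \<theta>\<^sup>2 = 1 - (1 - \<theta>)\<^sup>2\<close>, the condition on
    \<open>t\<close> bounds the deviation of each \<open>\<theta>\<close> from 1, and thus
    \<open>\<delta>\<close>.\<close>
  have t_ge: "t \<ge> 1 \<and> t * (1 - \<theta>)\<^sup>2 \<le> t - 1"
    if \<theta>: "\<theta> \<in> {0<..<2}" "t \<ge> 1 / (2 * \<theta> - \<theta>\<^sup>2)" for \<theta>
  proof -
    have d: "2 * \<theta> - \<theta>\<^sup>2 > 0" using \<theta>(1) by (simp add: power2_eq_square)
    have d1: "2 * \<theta> - \<theta>\<^sup>2 = 1 - (1 - \<theta>)\<^sup>2" by (simp add: power2_eq_square algebra_simps)
    have t1: "1 \<le> t * (1 - (1 - \<theta>)\<^sup>2)" using \<theta>(2) d unfolding d1 by (simp add: field_simps)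
    then have "t > 0" using d unfolding d1 by (smt (verit) mult_nonpos_nonneg)
    then have "t * (1 - \<theta>)\<^sup>2 \<ge> 0" by simp
    then show ?thesis using t1 by (simp add: algebra_simps)
  qed
  have tm: "t \<ge> 1" "t * (1 - \<theta>m)\<^sup>2 \<le> t - 1" and tp: "t * (\<theta>p - 1)\<^sup>2 \<le> t - 1"
    using t_ge[of \<theta>m] t_ge[of \<theta>p] assms(2,3,5) by (auto simp: power2_commute)
  have t: "t > 1" using tm(1) assms(9) by simp
  define K where "K = nat \<lceil>t * real k\<rceil>"
  have K: "t * real k \<le> real K" unfolding K_def by (rule of_nat_ceiling)
  have "1 * 1 \<le> t * real k" using t assms(1) by (intro mult_mono) auto
  then have K1: "K \<ge> 1" using K by linarith
  note rip = sripD[OF assms(4), folded K_def]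
  have UNIV_half: "real (card (UNIV :: 'm set)) \<ge> real CARD('m) / 2" by simp
  \<comment> \<open>Testing on a unit coordinate vector orders the two bounds, so
    \<open>1 - \<theta>m\<close> and \<open>\<theta>p - 1\<close> cannot both be negative.\<close>
  have "sparse K (axis undefined 1 :: real ^ 'n)"
    using K1 by (simp add: sparse_def axis_def)
  from rip[OF this UNIV_half] have "\<theta>m \<le> \<theta>p" by simp
  then have \<delta>: "\<delta> \<ge> 0" using assms(8) by linarith
  define s where "s = sqrt (t * (t - 1))"
  define g where "g = s - \<delta> * t"
  have s: "s > 0" "s\<^sup>2 = t * (t - 1)" using t by (auto simp: s_def)
  have "t * \<delta>\<^sup>2 \<le> t - 1" using tm tp assms(8) by (auto simp: max_def)
  then have "t * (t * \<delta>\<^sup>2) \<le> t * (t - 1)" using t by (intro mult_left_mono) auto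
  then have "(\<delta> * t)\<^sup>2 \<le> s\<^sup>2" unfolding s(2) by (simp add: power_mult_distrib power2_eq_square mult_ac)
  then have "\<delta> * t \<le> s" by (rule power2_le_imp_le) (use s in simp)
  \<comment> \<open>Only the weak inequality follows from the bound on \<open>t\<close>; strictness
    comes from the nonzero denominator of \<open>c2\<close>.\<close>
  then have g: "g > 0" using assms(11) by (simp add: g_def s_def)
  have sol: "(norm (\<bar>A *v xh\<bar> - \<bar>A *v x0\<bar>))\<^sup>2 \<le> \<epsilon>\<^sup>2" "l1_norm xh \<le> l1_norm x0"
    using assms(7) by (force simp: phaseless_l1_solution_def is_arg_min_def not_less)+
  obtain I h where I: "real (card I) \<ge> real CARD('m) / 2" and h: "h = xh - x0 \<or> h = xh + x0"
    and Bh: "norm (row_submatrix A I *v h) \<le> \<epsilon>"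
    using abs_minus_or_plus_vec[OF sol(1) assms(6)] by blast
  obtain z where z: "sparse k z" "sigma1 k x0 = l1_norm (x0 - z)"
    using sigma1_attained(1) by blast
  obtain S where S: "card S \<le> k" "\<And>T. card T \<le> k \<Longrightarrow> (\<Sum>i\<in>T. \<bar>h $ i\<bar>) \<le> (\<Sum>i\<in>S. \<bar>h $ i\<bar>)"
    "\<And>j. j \<notin> S \<Longrightarrow> real k * \<bar>h $ j\<bar> \<le> (\<Sum>i\<in>S. \<bar>h $ i\<bar>)"
    using ex_largest_entries by blast
  have l1_minus: "l1_norm (- y) = l1_norm y" for y :: "real ^ 'n" by (simp add: l1_norm_def)
  have cone: "(\<Sum>i\<in>-S. \<bar>h $ i\<bar>) \<le> (\<Sum>i\<in>S. \<bar>h $ i\<bar>) + 2 * sigma1 k x0"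
    using h
  proof
    assume "h = xh - x0"
    then show ?thesis using l1_cone[of x0 h k z S] sol(2) z S(2) by simp
  next
    \<comment> \<open>Now \<open>xh = - x0 + h\<close>, so the cone bound is applied at
      \<open>- x0\<close>, which has the same l1 norm and is approximated by
      \<open>- z\<close>.\<close>
    assume "h = xh + x0"
    moreover have "sparse k (- z)" using z(1) by (simp add: sparse_def)
    ultimately show ?thesis
      using l1_cone[of "- x0" h k "- z" S] sol(2) z(2) S(2) l1_minus[of x0] l1_minus[of "x0 - z"]
      by simp
  qed
  have \<sigma>: "2 * sigma1 k x0 \<ge> 0" unfolding z(2) by (simp add: l1_norm_def sum_nonneg)
  define P where "P = 2 * sigma1 k x0 / sqrt (real k)"
  have rip_lower: "(1 - \<delta>) * (norm x)\<^sup>2 \<le> (norm (row_submatrix A I *v x))\<^sup>2" if "sparse K x" for x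
    by (rule order_trans[OF mult_right_mono rip(1)[OF that I]]) (use assms(8) in auto)
  have rip_upper: "(norm (row_submatrix A I *v x))\<^sup>2 \<le> (1 + \<delta>) * (norm x)\<^sup>2" if "sparse K x" for x
    by (rule order_trans[OF rip(2)[OF that I] mult_right_mono]) (use assms(8) in auto)
  have "norm h \<le> sqrt 2 * ((s * sqrt (1 + \<delta>) * \<epsilon> + \<delta> * P) / g + sqrt (2 * g * \<delta>) / (2 * g) * P) + P"
    unfolding s_def g_def P_def
    using norm_le_of_rip_cone[OF assms(1) t K \<delta> _ rip_lower rip_upper Bh \<sigma> S(1,3) cone]
      g unfolding g_def s_def by simp
  also have "\<dots> = sqrt 2 * sqrt (1 + \<delta>) * (s / g) * \<epsilon>
      + ((sqrt 2 * \<delta> + sqrt 2 * sqrt 2 * sqrt (g * \<delta>) / 2) / g + 1) * P"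
    using g by (simp add: real_sqrt_mult field_simps)
  also have "\<dots> = c1 * \<epsilon> + c2 * P"
  proof -
    \<comment> \<open>This turns \<open>g\<close> into \<open>s\<close> times the denominator of
      \<open>c1\<close>.\<close>
    have "s * sqrt (t / (t - 1)) = t"
      using t by (simp add: s_def real_sqrt_mult real_sqrt_divide)
    then have "g = s * (1 - sqrt (t / (t - 1)) * \<delta>)" by (simp add: g_def algebra_simps)
    then have "s / g = 1 / (1 - sqrt (t / (t - 1)) * \<delta>)" using s by simp
    then have "c1 = sqrt 2 * sqrt (1 + \<delta>) * (s / g)" unfolding assms(12) real_sqrt_mult by simp
    moreover have "c2 = (sqrt 2 * \<delta> + sqrt 2 * sqrt 2 * sqrt (g * \<delta>) / 2) / g + 1"
      by (simp add: assms(13) g_def s_def)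
    ultimately show ?thesis by simp
  qed
  finally show ?thesis using h unfolding P_def by auto
qed

end
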